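(* Let $(\lambda_i,u_i)$ be exact finite eigenpairs of the differential eigenvalue problem $\mathcal{A}u_i=\lambda_i\mathcal{B}u_i$, $i=1,2,\dots,LM$. Assume that the eigenvalues are ordered so that the filter function has decreasing magnitude, $|f_N(\lambda_i)|\ge|f_N(\lambda_{i+1})|$. Let $\mathcal{P}^{(\ell)}$ be the orthogonal projector onto $\mathscr{R}(\widehat S^{(\ell)})$, and let $\mathcal{P}_{LM}$ be the spectral projector with invariant subspace $\operatorname{span}\{u_1,u_2,\dots,u_{LM}\}$. Assume that $\mathcal{P}_{LM}\widehat S^{(0)}$ has full rank, where $\widehat S^{(0)}=[V,\mathcal{C}V,\dots,\mathcal{C}^{M-1}V]$. Then for each eigenfunction $u_i$, $i=1,2,\dots,LM$, there exists a unique function $s_i\in\mathscr{R}([V,\mathcal{C}V,\dots,\mathcal{C}^{M-1}V])$ such that $\mathcal{P}_{LM}s_i=u_i$, and the following inequality is satisfied: $$\|(I-\mathcal{P}^{(\ell)})u_i\|_{\mathcal{H}}\le\alpha\,\beta_i\left|\frac{f_N(\lambda_{LM+1})}{f_N(\lambda_i)}\right|^{\ell},\qquad i=1,2,\dots,LM,\quad \ell=1,2,\dots,$$ where $\alpha$ is a constant (independent of $i$ and $\ell$) and $\beta_i=\|u_i-s_i\|_{\mathcal{H}}$.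
   Context: Setting. $\mathcal{H}$ is a Hilbert space of functions on an interval with norm $\|\cdot\|_{\mathcal H}$, and $\mathcal{A},\mathcal{B}$ are linear ordinary differential operators acting on functions from $\mathcal{H}$. One considers the differential eigenvalue problem $\mathcal{A}u_i=\lambda_i\mathcal{B}u_i$ with boundary conditions, and $(z\mathcal{B}-\mathcal{A})^{-1}$ denotes the solution operator subject to these boundary conditions. $\Omega\subset\mathbb{C}$ is a simply connected open set whose boundary $\Gamma$ is a rectifiable simple closed curve. The spectrum is discrete and does not intersect $\Gamma$, only finitely many finite eigenvalues, counting multiplicities, lie in $\Omega$, and there are eigenfunctions that form a basis of the invariant subspace associated with the eigenvalues in $\Omega$. Assumptions for the error analysis. $\mathcal{B}$ is invertible and all the eigenvalues are isolated, so that $$(z\mathcal{B}-\mathcal{A})^{-1}\mathcal{B}=\sum_{i=1}^\infty\frac{1}{z-\lambda_i}\mathcal{P}_i,$$ where $\mathcal{P}_i$ is a spectral projector associated with $\lambda_i$ and $\mathcal{P}_i\mathcal{P}_j=\delta_{ij}\mathcal{P}_i$. Let $\mathcal{C}=\sum_i\lambda_i\mathcal{P}_i$. Let $z_j,\omega_j\in\mathbb{C}$ ($j=1,\dots,N$) be quadrature points and weights (for approximating contour integrals over $\Gamma$) satisfying $$\sum_{j=1}^N\omega_jz_j^{-1}\ne0,\qquad \sum_{j=1}^N\omega_jz_j^k=0\quad(k=0,1,\dots,N-2).$$ Filter function. $f_N(\lambda)=\sum_{j=1}^N\dfrac{\omega_j}{z_j-\lambda}$. Quasi-matrices. A quasi-matrix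 $V=[v_1,\dots,v_L]:\mathbb{C}^L\to\mathcal{H}$ is a linear map whose columns are functions in $\mathcal{H}$, and operators act on it columnwise. $\mathscr{R}(V)=\{V\boldsymbol x:\boldsymbol x\in\mathbb{C}^L\}$ is its range. Subspace iteration. Let $L,M,N\ge1$ be integers and let $V:\mathbb{C}^L\to\mathcal{H}$ be an initial quasi-matrix. Put $\widehat S_0^{(0)}=V$ and $$\widehat S_0^{(\nu)}=\sum_{j=1}^N\omega_j(z_j\mathcal{B}-\mathcal{A})^{-1}\mathcal{B}\,\widehat S_0^{(\nu-1)},\qquad \nu=1,2,\dots,\ell-1,$$ and for $\ell\ge1$ $$\widehat S^{(\ell)}=[\widehat S_0^{(\ell)},\widehat S_1^{(\ell)},\dots,\widehat S_{M-1}^{(\ell)}],\qquad \widehat S_k^{(\ell)}=\sum_{j=1}^N\omega_jz_j^k(z_j\mathcal{B}-\mathcal{A})^{-1}\mathcal{B}\,\widehat S_0^{(\ell-1)},\quad k=0,\dots,M-1.$$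
   Formalization: Adds M ≤ N (for M > N the range of Ŝ^(ℓ) has dimension at most LN < LM and the bound fails); the series over P_i is read as converging unconditionally and pointwise on the domain of B, with V in that domain and C^kV defined. *)

theory Defs
  imports "HOL-Analysis.Analysis"
begin

section \<open>Complex Hilbert spaces\<close>

text \<open>
  The distribution only has real inner product spaces.  A complex inner product is added on top of
  \<^class>\<open>real_inner\<close>, whose inner product is its real part, so that norm, topology
  and infinite sums are the library ones.  The product is antilinear in its first argument.
\<close>

class complex_inner = real_inner +
  fixes scaleC :: "complex \<Rightarrow> 'a \<Rightarrow> 'a" (infixr \<open>*\<^sub>C\<close> 75)
    and cinner :: "'a \<Rightarrow> 'a \<Rightarrow> complex"
  assumes scaleC_add_right: "c *\<^sub>C (x + y) = c *\<^sub>C x + c *\<^sub>C y"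
    and scaleC_add_left: "(c + d) *\<^sub>C x = c *\<^sub>C x + d *\<^sub>C x"
    and scaleC_scaleC: "c *\<^sub>C (d *\<^sub>C x) = (c * d) *\<^sub>C x"
    and scaleC_of_real: "complex_of_real r *\<^sub>C x = r *\<^sub>R x"
    and cinner_commute: "cinner x y = cnj (cinner y x)"
    and cinner_add_right: "cinner x (y + z) = cinner x y + cinner x z"
    and cinner_scaleC_right: "cinner x (c *\<^sub>C y) = c * cinner x y"
    and Re_cinner: "Re (cinner x y) = inner x y"

class chilbert_space = complex_inner + complete_space

lemma scaleC_one: "1 *\<^sub>C x = (x :: 'a::complex_inner)"
  using scaleC_of_real[of 1 x] by simp

global_interpretation complex_vector:
  vector_space "scaleC :: complex \<Rightarrow> 'a \<Rightarrow> 'a::complex_inner"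
  by unfold_locales
    (auto simp: scaleC_add_right scaleC_add_left scaleC_scaleC scaleC_one)

definition clinear_on :: "'a set \<Rightarrow> ('a::complex_inner \<Rightarrow> 'b::complex_inner) \<Rightarrow> bool" where
  "clinear_on D T \<longleftrightarrow> complex_vector.subspace D \<and>
     (\<forall>u\<in>D. \<forall>v\<in>D. T (u + v) = T u + T v) \<and> (\<forall>c. \<forall>u\<in>D. T (c *\<^sub>C u) = c *\<^sub>C T u)"

definition cfunctional_on :: "'a set \<Rightarrow> ('a::complex_inner \<Rightarrow> complex) \<Rightarrow> bool" where
  "cfunctional_on D b \<longleftrightarrow> complex_vector.subspace D \<and>
     (\<forall>u\<in>D. \<forall>v\<in>D. b (u + v) = b u + b v) \<and> (\<forall>c. \<forall>u\<in>D. b (c *\<^sub>C u) = c * b u)"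

definition orth_proj :: "'a::complex_inner set \<Rightarrow> 'a \<Rightarrow> 'a" where
  "orth_proj S x = (THE y. y \<in> S \<and> (\<forall>s\<in>S. cinner s (x - y) = 0))"


section \<open>Ordinary differential operators on a Hilbert space of functions\<close>

text \<open>
  As in \<open>L\<^sup>2\<close>, an element \<open>u\<close> of the Hilbert space stands for the function \<open>ev u\<close> on the
  interval \<open>I\<close>, determined up to a null set.
\<close>

definition function_space :: "real set \<Rightarrow> ('h::chilbert_space \<Rightarrow> real \<Rightarrow> complex) \<Rightarrow> bool" where
  "function_space I ev \<longleftrightarrow> is_interval I \<and> interior I \<noteq> {} \<and>
     (\<forall>u. ev u \<in> borel_measurable (lebesgue_on I)) \<and>
     (\<forall>u v. AE x in lebesgue_on I. ev (u + v) x = ev u x + ev v x) \<and>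
     (\<forall>c u. AE x in lebesgue_on I. ev (c *\<^sub>C u) x = c * ev u x) \<and>
     (\<forall>u. (AE x in lebesgue_on I. ev u x = 0) \<longrightarrow> u = 0)"

text \<open>
  \<open>w 0\<close> is \<open>n\<close> times differentiable with derivatives \<open>w 1, \<dots>, w n\<close>, in the sense usual for
  differential operators: \<open>w 0, \<dots>, w (n - 1)\<close> are locally absolutely continuous in the interior
  of \<open>I\<close>.
\<close>

definition derivatives_on :: "real set \<Rightarrow> nat \<Rightarrow> (nat \<Rightarrow> real \<Rightarrow> complex) \<Rightarrow> bool" where
  "derivatives_on I n w \<longleftrightarrow>
     (\<forall>k<n. \<forall>s\<in>interior I. \<forall>t\<in>interior I. s \<le> t \<longrightarrow>
        w (Suc k) absolutely_integrable_on {s..t} \<and>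
        integral {s..t} (w (Suc k)) = w k t - w k s)"

definition linear_ode_operator ::
  "real set \<Rightarrow> ('h::chilbert_space \<Rightarrow> real \<Rightarrow> complex) \<Rightarrow> 'h set \<Rightarrow> ('h \<Rightarrow> 'h) \<Rightarrow> bool" where
  "linear_ode_operator I ev D T \<longleftrightarrow> clinear_on D T \<and>
     (\<exists>n c. (\<forall>k\<le>n. c k \<in> borel_measurable (lebesgue_on I)) \<and>
       (\<forall>u\<in>D. \<exists>w. derivatives_on I n w \<and>
         (AE x in lebesgue_on I. ev u x = w 0 x) \<and>
         (AE x in lebesgue_on I. ev (T u) x = (\<Sum>k\<le>n. c k x * w k x))))"

text \<open>
  A (homogeneous) boundary condition is \<open>b u = 0\<close> for a linear functional \<open>b\<close> that only sees \<open>u\<close>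
  near the end points: it vanishes on functions that are zero outside a compact subinterval of the
  interior.  This covers separated, periodic and singular boundary conditions alike.
\<close>

definition boundary_functional ::
  "real set \<Rightarrow> ('h::chilbert_space \<Rightarrow> real \<Rightarrow> complex) \<Rightarrow> 'h set \<Rightarrow> ('h \<Rightarrow> complex) \<Rightarrow> bool" where
  "boundary_functional I ev E b \<longleftrightarrow> cfunctional_on E b \<and>
     (\<forall>u\<in>E. (\<exists>s t. {s..t} \<subseteq> interior I \<and>
                 (AE x in lebesgue_on I. x \<notin> {s..t} \<longrightarrow> ev u x = 0)) \<longrightarrow> b u = 0)"

definition bc_domain :: "'h set \<Rightarrow> 'h set \<Rightarrow> ('h \<Rightarrow> complex) set \<Rightarrow> 'h set" where
  "bc_domain DA DB BC = {u \<in> DA \<inter> DB. \<forall>b\<in>BC. b u = 0}"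


section \<open>The differential eigenvalue problem\<close>

text \<open>In this section \<open>D\<close> is the set of functions satisfying the boundary conditions.\<close>

definition eigenpair ::
  "('h::chilbert_space \<Rightarrow> 'h) \<Rightarrow> ('h \<Rightarrow> 'h) \<Rightarrow> 'h set \<Rightarrow> complex \<Rightarrow> 'h \<Rightarrow> bool" where
  "eigenpair A B D \<mu> u \<longleftrightarrow> u \<in> D \<and> u \<noteq> 0 \<and> A u = \<mu> *\<^sub>C B u"

definition solution_op ::
  "('h::chilbert_space \<Rightarrow> 'h) \<Rightarrow> ('h \<Rightarrow> 'h) \<Rightarrow> 'h set \<Rightarrow> complex \<Rightarrow> 'h \<Rightarrow> 'h" where
  "solution_op A B D z = inv_into D (\<lambda>u. z *\<^sub>C B u - A u)"

definition spectrum ::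
  "('h::chilbert_space \<Rightarrow> 'h) \<Rightarrow> ('h \<Rightarrow> 'h) \<Rightarrow> 'h set \<Rightarrow> complex set" where
  "spectrum A B D = {z. \<not> (bij_betw (\<lambda>u. z *\<^sub>C B u - A u) D UNIV \<and>
                           (\<exists>K. \<forall>h. norm (solution_op A B D z h) \<le> K * norm h))}"

text \<open>
  Eigenvalues are listed with multiplicity, so several projectors may belong to the same
  eigenvalue, and the Riesz projector of an eigenvalue \<open>\<mu>\<close> is the sum of the projectors listed
  for it.
\<close>

definition spectral_projector ::
  "('h::chilbert_space \<Rightarrow> 'h) \<Rightarrow> ('h \<Rightarrow> 'h) \<Rightarrow> 'h set \<Rightarrow> complex \<Rightarrow> ('h \<Rightarrow> 'h) \<Rightarrow> bool" where
  "spectral_projector A B D \<mu> P \<longleftrightarrow>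
     bounded_linear P \<and> (\<forall>c x. P (c *\<^sub>C x) = c *\<^sub>C P x) \<and> (\<forall>x. P (P x) = P x) \<and>
     (\<exists>x. P x \<noteq> 0) \<and> (\<forall>x. P x \<noteq> 0 \<longrightarrow> eigenpair A B D \<mu> (P x))"

text \<open>
  Infinite sums of projectors are pointwise and unconditional, because the eigenvalues are
  reordered later (according to a filter function) without changing the sums.
  The operator \<open>\<Sum>i. lam i P i\<close> is unbounded in general; its domain consists of the functions for
  which the sum converges.
\<close>

definition specC :: "(nat \<Rightarrow> complex) \<Rightarrow> (nat \<Rightarrow> 'h \<Rightarrow> 'h) \<Rightarrow> 'h::chilbert_space \<Rightarrow> 'h" where
  "specC lam P x = infsum (\<lambda>i. lam i *\<^sub>C P i x) {1..}"

definition specC_dom :: "(nat \<Rightarrow> complex) \<Rightarrow> (nat \<Rightarrow> 'h \<Rightarrow> 'h) \<Rightarrow> 'h::chilbert_space set" where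
  "specC_dom lam P = {x. (\<lambda>i. lam i *\<^sub>C P i x) summable_on {1..}}"

definition proj_sum :: "(nat \<Rightarrow> 'h \<Rightarrow> 'h) \<Rightarrow> nat set \<Rightarrow> 'h::chilbert_space \<Rightarrow> 'h" where
  "proj_sum P J x = (\<Sum>i\<in>J. P i x)"

definition rectifiable :: "(real \<Rightarrow> 'a::metric_space) \<Rightarrow> bool" where
  "rectifiable g \<longleftrightarrow> path g \<and>
     (\<exists>K. \<forall>n (t :: nat \<Rightarrow> real). mono_on {..n} t \<and> t ` {..n} \<subseteq> {0..1} \<longrightarrow>
        (\<Sum>i<n. dist (g (t i)) (g (t (Suc i)))) \<le> K)"


section \<open>Quasi-matrices and the subspace iteration\<close>

text \<open>
  A quasi-matrix is the list of its columns.  A coefficient vector is a sequence of which only the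
  entries below the number of columns matter.  Operators act on quasi-matrices by
  \<^const>\<open>map\<close>, and juxtaposition of blocks is \<^const>\<open>concat\<close>.
\<close>

definition qapply :: "'h::chilbert_space list \<Rightarrow> (nat \<Rightarrow> complex) \<Rightarrow> 'h" where
  "qapply Q x = (\<Sum>i<length Q. x i *\<^sub>C Q ! i)"

definition qrange :: "'h::chilbert_space list \<Rightarrow> 'h set" where
  "qrange Q = range (qapply Q)"

definition full_rank :: "'h::chilbert_space list \<Rightarrow> bool" where
  "full_rank Q \<longleftrightarrow> complex_vector.dim (qrange Q) = length Q"

definition filter_fun :: "nat \<Rightarrow> (nat \<Rightarrow> complex) \<Rightarrow> (nat \<Rightarrow> complex) \<Rightarrow> complex \<Rightarrow> complex" where
  "filter_fun N z \<omega> \<mu> = (\<Sum>j=1..N. \<omega> j / (z j - \<mu>))"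

definition moment_op ::
  "('h::chilbert_space \<Rightarrow> 'h) \<Rightarrow> ('h \<Rightarrow> 'h) \<Rightarrow> 'h set \<Rightarrow>
   nat \<Rightarrow> (nat \<Rightarrow> complex) \<Rightarrow> (nat \<Rightarrow> complex) \<Rightarrow> nat \<Rightarrow> 'h \<Rightarrow> 'h" where
  "moment_op A B D N z \<omega> k v = (\<Sum>j=1..N. (\<omega> j * z j ^ k) *\<^sub>C solution_op A B D (z j) (B v))"

primrec S0_iter ::
  "('h::chilbert_space \<Rightarrow> 'h) \<Rightarrow> ('h \<Rightarrow> 'h) \<Rightarrow> 'h set \<Rightarrow>
   nat \<Rightarrow> (nat \<Rightarrow> complex) \<Rightarrow> (nat \<Rightarrow> complex) \<Rightarrow> 'h list \<Rightarrow> nat \<Rightarrow> 'h list" where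
  "S0_iter A B D N z \<omega> V 0 = V"
| "S0_iter A B D N z \<omega> V (Suc \<nu>) = map (moment_op A B D N z \<omega> 0) (S0_iter A B D N z \<omega> V \<nu>)"

text \<open>Meaningful for \<open>l \<ge> 1\<close> only.\<close>

definition S_hat ::
  "('h::chilbert_space \<Rightarrow> 'h) \<Rightarrow> ('h \<Rightarrow> 'h) \<Rightarrow> 'h set \<Rightarrow>
   nat \<Rightarrow> (nat \<Rightarrow> complex) \<Rightarrow> (nat \<Rightarrow> complex) \<Rightarrow> nat \<Rightarrow> 'h list \<Rightarrow> nat \<Rightarrow> 'h list" where
  "S_hat A B D N z \<omega> M V l =
     concat (map (\<lambda>k. map (moment_op A B D N z \<omega> k) (S0_iter A B D N z \<omega> V (l - 1))) [0..<M])"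

definition S_init ::
  "(nat \<Rightarrow> complex) \<Rightarrow> (nat \<Rightarrow> 'h \<Rightarrow> 'h) \<Rightarrow> nat \<Rightarrow> 'h::chilbert_space list \<Rightarrow> 'h list" where
  "S_init lam P M V = concat (map (\<lambda>k. map (specC lam P ^^ k) V) [0..<M])"

end

theory Submission
  imports Defs "HOL-Computational_Algebra.Polynomial"
begin

text \<open>
  Write \<open>f\<close> for the filter function, \<open>f j\<close> for its value at \<open>lam j\<close>, \<open>C\<close> for the operator
  \<open>\<Sum>i. lam i P i\<close>, and \<open>n = L * M\<close>.  Inserting the expansion of the resolvent into the quadrature
  rule shows that one step of the iteration multiplies the \<open>j\<close>-th component \<open>P j v\<close> by \<open>f j\<close>, and
  that the \<open>k\<close>-th moment multiplies it by \<open>lam j ^ k * f j\<close>; the latter uses the vanishing moments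
  and \<open>k < M \<le> N\<close> (\<open>filter_fun_power\<close>, \<open>has_sum_moment\<close>).  The block structure of the iterate
  therefore mirrors that of \<open>[V, C V, \<dots>]\<close>: if \<open>s\<close> is a combination of the initial columns, the
  same combination of the columns of the \<open>l\<close>-th iterate is \<open>w = \<Sum>j. f j ^ l P j s\<close>
  (\<open>has_sum_S_hat\<close>).

  Existence and uniqueness of \<open>s\<close> are linear algebra: the projector onto the first \<open>n\<close> components
  keeps the \<open>n\<close> initial columns independent, so it maps their span bijectively onto the span of
  the eigenfunctions (\<open>full_rank_map_ex1\<close>).

  For the estimate, let \<open>s\<close> be projected to \<open>u i\<close>.  The first \<open>n\<close> components of \<open>w\<close> add up to
  \<open>f i ^ l\<close> times \<open>u i\<close>, because \<open>P j (u i)\<close> can only be nonzero if \<open>lam j = lam i\<close>.  Thus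
  \<open>w / f i ^ l\<close> is an element of the range of the iterate whose difference from \<open>u i\<close> is the sum of
  \<open>(f j / f i) ^ l P j s\<close> over \<open>j > n\<close>, and the orthogonal projection of \<open>u i\<close> is at least as close
  to \<open>u i\<close> (\<open>norm_diff_orth_proj_le\<close>).  Taking out \<open>(f (n + 1) / f i) ^ l\<close> leaves the
  multipliers \<open>(f j / f (n + 1)) ^ (l - 1)\<close>, which are bounded by \<open>1\<close>, on the series with terms
  \<open>(f j / f (n + 1)) P j s\<close>.  That series converges unconditionally, being up to a
  constant factor a part of the expansion of \<open>w\<close> for \<open>l = 1\<close>, and bounded multipliers of an
  unconditionally convergent series yield bounded sums (\<open>has_sum_multipliers_bounded\<close>); hence a bound independent of \<open>l\<close>
  (\<open>filtered_remainder_bound\<close>).  All divisions are legitimate because \<open>f\<close> has no zeros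
  (\<open>filter_fun_nz\<close>), which follows from the condition on \<open>\<Sum>j. \<omega> j / z j\<close>.
\<close>

section \<open>Complex inner product spaces\<close>

lemma scaleR_scaleC: "r *\<^sub>R (x::'a::complex_inner) = complex_of_real r *\<^sub>C x"
  by (simp add: scaleC_of_real)

lemma cinner_zero_right [simp]: "cinner (x::'a::complex_inner) 0 = 0"
  using cinner_add_right[of x 0 0] by simp

lemma cinner_zero_left [simp]: "cinner 0 (x::'a::complex_inner) = 0"
  by (metis cinner_commute cinner_zero_right complex_cnj_zero)

lemma cinner_add_left: "cinner (x + y) (w::'a::complex_inner) = cinner x w + cinner y w"
  by (metis cinner_add_right cinner_commute complex_cnj_add)

lemma cinner_scaleC_left: "cinner (c *\<^sub>C x) (y::'a::complex_inner) = cnj c * cinner x y"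
  by (metis cinner_commute cinner_scaleC_right complex_cnj_mult)

lemma cinner_diff_right: "cinner (x::'a::complex_inner) (y - w) = cinner x y - cinner x w"
  using cinner_add_right[of x "y - w" w] by (simp add: algebra_simps)

lemma cinner_same: "cinner x x = complex_of_real ((norm (x::'a::complex_inner))\<^sup>2)"
proof (rule complex_eqI)
  show "Im (cinner x x) = Im (complex_of_real ((norm x)\<^sup>2))"
    using arg_cong[OF cinner_commute[of x x], of Im] by simp
qed (simp add: Re_cinner power2_norm_eq_inner)

lemma norm_scaleC: "norm (c *\<^sub>C (x::'a::complex_inner)) = cmod c * norm x"
proof -
  have "complex_of_real ((norm (c *\<^sub>C x))\<^sup>2) = complex_of_real ((cmod c * norm x)\<^sup>2)"
    unfolding cinner_same[symmetric] cinner_scaleC_left cinner_scaleC_right power_mult_distrib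
      of_real_mult complex_norm_square[of c]
    by (simp only: cinner_same ac_simps)
  then have "(norm (c *\<^sub>C x))\<^sup>2 = (cmod c * norm x)\<^sup>2"
    using of_real_eq_iff by blast
  then show ?thesis by (simp add: power2_eq_iff_nonneg)
qed

lemma bounded_linear_scaleC: "bounded_linear (\<lambda>x::'a::complex_inner. c *\<^sub>C x)"
proof
  show "c *\<^sub>C (r *\<^sub>R x) = r *\<^sub>R (c *\<^sub>C x)" for r and x :: 'a
    by (simp add: scaleR_scaleC scaleC_scaleC mult.commute)
  show "\<exists>K. \<forall>x::'a. norm (c *\<^sub>C x) \<le> norm x * K"
    by (rule exI[of _ "cmod c"]) (simp add: norm_scaleC mult.commute)
qed (rule scaleC_add_right)

lemma has_sum_scaleC:
  "(f has_sum x) S \<Longrightarrow> ((\<lambda>i. c *\<^sub>C f i) has_sum c *\<^sub>C (x::'a::complex_inner)) S"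
  by (rule has_sum_bounded_linear[OF bounded_linear_scaleC])

text \<open>
  Gram--Schmidt, one vector at a time: if \<open>a\<close> leaves the remainder \<open>a - p\<close> modulo the smaller
  span, the component along that remainder is all that has to be added to the smaller projection.
\<close>

lemma orth_proj_exists:
  fixes T :: "'a::complex_inner set"
  assumes "finite T"
  shows "\<exists>y\<in>complex_vector.span T. \<forall>s\<in>complex_vector.span T. cinner s (x - y) = 0"
  using assms
proof (induction T arbitrary: x rule: finite_induct)
  case empty
  then show ?case by simp
next
  case (insert a T)
  let ?S = "complex_vector.span T" and ?S' = "complex_vector.span (insert a T)"
  obtain p where p: "p \<in> ?S" "\<forall>s\<in>?S. cinner s (a - p) = 0" using insert.IH by blast
  obtain q where q: "q \<in> ?S" "\<forall>s\<in>?S. cinner s (x - q) = 0" using insert.IH by blast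
  define r where "r = a - p"
  \<comment> \<open>division by zero yields \<open>c = 0\<close> for \<open>r = 0\<close>, when the span has not grown\<close>
  define c where "c = cinner r (x - q) / cinner r r"
  define y where "y = q + c *\<^sub>C r"
  have sub: "?S \<subseteq> ?S'" by (rule complex_vector.span_mono) auto
  have "r \<in> ?S'"
    unfolding r_def using p sub complex_vector.span_base[of a "insert a T"]
    by (auto intro: complex_vector.span_diff)
  then have y: "y \<in> ?S'"
    unfolding y_def using q sub by (auto intro: complex_vector.span_add complex_vector.span_scale)
  have xy: "x - y = (x - q) - c *\<^sub>C r" by (simp add: y_def)
  have orth: "cinner s (x - y) = 0" if "s \<in> ?S" for s
    using p q that by (simp add: xy cinner_diff_right[of s "x - q"] cinner_scaleC_right r_def)
  have orth_r: "cinner r (x - y) = 0"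
    by (cases "r = 0") (auto simp: xy cinner_diff_right[of r "x - q"] cinner_scaleC_right c_def
        cinner_same)
  have "cinner s (x - y) = 0" if s: "s \<in> ?S'" for s
  proof -
    obtain k where k: "s - k *\<^sub>C a \<in> ?S"
      using s complex_vector.span_breakdown_eq by blast
    define t where "t = s - k *\<^sub>C a + k *\<^sub>C p"
    have "t \<in> ?S"
      unfolding t_def using k p by (auto intro: complex_vector.span_add complex_vector.span_scale)
    then have "cinner (t + k *\<^sub>C r) (x - y) = 0"
      unfolding cinner_add_left cinner_scaleC_left using orth orth_r by simp
    moreover have "s = t + k *\<^sub>C r"
      by (simp add: t_def r_def complex_vector.scale_right_diff_distrib)
    ultimately show ?thesis by simp
  qed
  with y show ?case by blast
qed

text \<open>The projection realises the distance to the subspace, by Pythagoras.\<close>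

lemma norm_diff_orth_proj_le:
  fixes T :: "'a::complex_inner set"
  assumes T: "finite T" and S: "S = complex_vector.span T" and w: "w \<in> S"
  shows "norm (x - orth_proj S x) \<le> norm (x - w)"
proof -
  have diff: "s - t \<in> S" if "s \<in> S" "t \<in> S" for s t
    using that S complex_vector.span_diff by blast
  obtain y where y: "y \<in> S" "\<forall>s\<in>S. cinner s (x - y) = 0"
    using orth_proj_exists[OF T] S by blast
  have uniq: "y' = y" if y': "y' \<in> S" "\<forall>s\<in>S. cinner s (x - y') = 0" for y'
  proof -
    have "cinner (y - y') ((x - y') - (x - y)) = 0"
      unfolding cinner_diff_right[of "y - y'" "x - y'"] using y y' diff by simp
    then show ?thesis by (simp add: cinner_same)
  qed
  have proj: "orth_proj S x = y"
    unfolding orth_proj_def by (rule the_equality) (use y uniq in blast)+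
  have "inner (y - w) (x - y) = 0"
    using y(2) diff[OF y(1) w] Re_cinner[of "y - w" "x - y"] by simp
  then have "(norm (x - w))\<^sup>2 = (norm (x - y))\<^sup>2 + (norm (y - w))\<^sup>2"
    by (simp add: power2_norm_eq_inner inner_diff_left inner_diff_right inner_commute)
  then have "(norm (x - y))\<^sup>2 \<le> (norm (x - w))\<^sup>2" by simp
  then show ?thesis unfolding proj by (rule power2_le_imp_le) simp
qed


section \<open>Bounded multipliers of an unconditionally convergent series\<close>

lemma has_sum_finite_sums_bounded:
  fixes a :: "'i \<Rightarrow> 'a::real_normed_vector"
  assumes "(a has_sum x) S"
  shows "\<exists>C. \<forall>F. finite F \<and> F \<subseteq> S \<longrightarrow> norm (sum a F) \<le> C"
proof -
  have "eventually (\<lambda>F. dist (sum a F) x < 1) (finite_subsets_at_top S)"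
    using assms unfolding has_sum_def by (rule tendstoD) simp
  then obtain X where X: "finite X" "X \<subseteq> S"
    and "\<forall>Y. finite Y \<and> X \<subseteq> Y \<and> Y \<subseteq> S \<longrightarrow> dist (sum a Y) x < 1"
    unfolding eventually_finite_subsets_at_top by blast
  then have near: "dist (sum a Y) x < 1" if "finite Y" "X \<subseteq> Y" "Y \<subseteq> S" for Y
    using that by blast
  have "norm (sum a F) \<le> norm x + 1 + (\<Sum>i\<in>X. norm (a i))" if F: "finite F" "F \<subseteq> S" for F
  proof -
    have "sum a (F \<union> X) = sum a F + sum a (X - F)"
      using sum.union_disjoint[of F "X - F" a] F X by simp
    then have "norm (sum a F) \<le> norm (sum a (F \<union> X)) + norm (sum a (X - F))"
      using norm_triangle_ineq4[of "sum a (F \<union> X)" "sum a (X - F)"] by simp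
    moreover have "norm (sum a (F \<union> X)) \<le> norm x + 1"
      using near[of "F \<union> X"] F X norm_triangle_sub[of "sum a (F \<union> X)" x] by (simp add: dist_norm)
    moreover have "norm (sum a (X - F)) \<le> (\<Sum>i\<in>X. norm (a i))"
      by (rule order_trans[OF norm_sum]) (use X in \<open>auto intro: sum_mono2\<close>)
    ultimately show ?thesis by simp
  qed
  then show ?thesis by blast
qed

text \<open>
  The terms with nonnegative and those with negative scalar product are collected into two partial
  sums; within each of them all signs agree, so that Cauchy--Schwarz can be applied to the sum.
\<close>

lemma sum_abs_inner_le:
  fixes a :: "'i \<Rightarrow> 'a::real_inner"
  assumes F: "finite F" and C: "\<And>G. G \<subseteq> F \<Longrightarrow> norm (sum a G) \<le> C"
  shows "(\<Sum>i\<in>F. \<bar>inner h (a i)\<bar>) \<le> 2 * C * norm h"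
proof -
  define G where "G = {i\<in>F. inner h (a i) \<ge> 0}"
  have bound: "\<bar>inner h (sum a H)\<bar> \<le> C * norm h" if "H \<subseteq> F" for H
    using Cauchy_Schwarz_ineq2[of h "sum a H"] mult_left_mono[OF C[OF that], of "norm h"]
    by (simp add: mult.commute)
  have "(\<Sum>i\<in>F. \<bar>inner h (a i)\<bar>) = (\<Sum>i\<in>G. \<bar>inner h (a i)\<bar>) + (\<Sum>i\<in>F - G. \<bar>inner h (a i)\<bar>)"
    using F by (intro sum.subset_diff[of G F, THEN trans]) (auto simp: G_def add.commute)
  also have "\<dots> = inner h (sum a G) - inner h (sum a (F - G))"
    by (auto simp: inner_sum_right G_def simp flip: sum_negf intro!: sum.cong)
  also have "\<dots> \<le> 2 * C * norm h"
    using bound[of G] bound[of "F - G"] by (auto simp: G_def)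
  finally show ?thesis .
qed

text \<open>
  The sum \<open>h\<close> is tested against itself, which turns the multipliers into factors of scalars.  The
  modulus of \<open>cinner h (a i)\<close> is at most \<open>\<bar>Re\<bar> + \<bar>Im\<bar>\<close>, and each of these two parts,
  summed over \<open>i\<close>, contributes at most \<open>2 * C * norm h\<close> by the previous lemma.
\<close>

lemma norm_multiplier_sum_le:
  fixes a :: "'i \<Rightarrow> 'a::complex_inner"
  assumes F: "finite F" and C: "\<And>G. G \<subseteq> F \<Longrightarrow> norm (sum a G) \<le> C"
    and m: "\<And>i. i \<in> F \<Longrightarrow> cmod (m i) \<le> 1"
  shows "norm (\<Sum>i\<in>F. m i *\<^sub>C a i) \<le> 4 * C"
proof -
  define h where "h = (\<Sum>i\<in>F. m i *\<^sub>C a i)"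
  have "inner h (m i *\<^sub>C a i) \<le> \<bar>inner h (a i)\<bar> + \<bar>inner (\<i> *\<^sub>C h) (a i)\<bar>" if "i \<in> F" for i
  proof -
    have "inner h (m i *\<^sub>C a i) \<le> cmod (m i) * cmod (cinner h (a i))"
      by (metis Re_cinner cinner_scaleC_right complex_Re_le_cmod norm_mult)
    also have "\<dots> \<le> cmod (cinner h (a i))"
      using m[OF that] by (simp add: mult_left_le_one_le)
    also have "\<dots> \<le> \<bar>Re (cinner h (a i))\<bar> + \<bar>Im (cinner h (a i))\<bar>" by (rule cmod_le)
    (* multiplying by the imaginary unit turns the imaginary part into a real part *)
    also have "Im (cinner h (a i)) = inner (\<i> *\<^sub>C h) (a i)"
      by (simp add: cinner_scaleC_left flip: Re_cinner)
    finally show ?thesis by (simp add: Re_cinner)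
  qed
  then have "inner h h \<le> (\<Sum>i\<in>F. \<bar>inner h (a i)\<bar> + \<bar>inner (\<i> *\<^sub>C h) (a i)\<bar>)"
    by (subst (2) h_def) (auto simp: inner_sum_right intro: sum_mono)
  also have "\<dots> \<le> 2 * C * norm h + 2 * C * norm (\<i> *\<^sub>C h)"
    unfolding sum.distrib by (intro add_mono sum_abs_inner_le F C)
  finally have "norm h * norm h \<le> (4 * C) * norm h"
    by (simp add: norm_scaleC power2_norm_eq_inner flip: power2_eq_square)
  then show ?thesis
    using C[of "{}"] unfolding h_def[symmetric]
    by (cases "h = 0") (auto simp: mult_le_cancel_right)
qed

text \<open>
  The \<open>+ 1\<close> in the proof only pays for replacing the infinite sum by a finite one.  The bound is
  uniform over all multipliers, which is where unconditional convergence is essential.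
\<close>

lemma has_sum_multipliers_bounded:
  fixes a :: "'i \<Rightarrow> 'a::complex_inner"
  assumes "a summable_on S"
  shows "\<exists>K\<ge>0. \<forall>m y. (\<forall>i\<in>S. cmod (m i) \<le> 1) \<and> ((\<lambda>i. m i *\<^sub>C a i) has_sum y) S \<longrightarrow> norm y \<le> K"
proof -
  obtain C where C: "\<And>F. finite F \<Longrightarrow> F \<subseteq> S \<Longrightarrow> norm (sum a F) \<le> C"
    using has_sum_finite_sums_bounded assms unfolding summable_on_def by metis
  have "norm y \<le> 4 * C + 1"
    if m: "\<forall>i\<in>S. cmod (m i) \<le> 1" and y: "((\<lambda>i. m i *\<^sub>C a i) has_sum y) S" for m y
  proof -
    obtain F where F: "finite F" "F \<subseteq> S" "dist (\<Sum>i\<in>F. m i *\<^sub>C a i) y \<le> 1"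
      using has_sum_finite_approximation[OF y, of 1] by auto
    have "norm (\<Sum>i\<in>F. m i *\<^sub>C a i) \<le> 4 * C"
      using F m by (intro norm_multiplier_sum_le C) (auto intro: finite_subset)
    then show ?thesis
      using F(3) norm_triangle_sub[of y "\<Sum>i\<in>F. m i *\<^sub>C a i"]
      by (simp add: dist_norm norm_minus_commute)
  qed
  moreover have "0 \<le> 4 * C + 1" using C[of "{}"] by simp
  ultimately show ?thesis by blast
qed


section \<open>Quasi-matrices\<close>

lemma qrange_eq_span: "qrange Q = complex_vector.span (set Q)"
proof (rule antisym)
  show "qrange Q \<subseteq> complex_vector.span (set Q)"
    unfolding qrange_def qapply_def
    by (auto intro!: complex_vector.span_sum complex_vector.span_scale intro: complex_vector.span_base)
  have "complex_vector.subspace (qrange Q)"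
    unfolding complex_vector.subspace_def
  proof (intro conjI ballI allI)
    show "0 \<in> qrange Q"
      unfolding qrange_def by (rule range_eqI[of _ _ "\<lambda>_. 0"]) (simp add: qapply_def)
    show "x + y \<in> qrange Q" if xy: "x \<in> qrange Q" "y \<in> qrange Q" for x y
    proof -
      obtain a b where "x = qapply Q a" "y = qapply Q b" using xy by (auto simp: qrange_def)
      then have "x + y = qapply Q (\<lambda>n. a n + b n)"
        by (simp add: qapply_def scaleC_add_left sum.distrib)
      then show ?thesis by (simp add: qrange_def)
    qed
    show "c *\<^sub>C x \<in> qrange Q" if x: "x \<in> qrange Q" for c x
    proof -
      obtain a where "x = qapply Q a" using x by (auto simp: qrange_def)
      then have "c *\<^sub>C x = qapply Q (\<lambda>n. c * a n)"
        by (simp add: qapply_def complex_vector.scale_sum_right scaleC_scaleC)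
      then show ?thesis by (simp add: qrange_def)
    qed
  qed
  moreover have "set Q \<subseteq> qrange Q"
  proof
    fix q assume "q \<in> set Q"
    then obtain n where n: "n < length Q" "q = Q ! n" by (auto simp: in_set_conv_nth)
    have "qapply Q (\<lambda>i. if i = n then 1 else 0) = (\<Sum>i<length Q. if i = n then Q ! i else 0)"
      unfolding qapply_def by (intro sum.cong) auto
    also have "\<dots> = q" using n by simp
    finally show "q \<in> qrange Q" by (metis qrange_def rangeI)
  qed
  ultimately show "complex_vector.span (set Q) \<subseteq> qrange Q"
    by (simp add: complex_vector.span_minimal)
qed

lemma qapply_map: "qapply (map F xs) x = (\<Sum>n<length xs. x n *\<^sub>C F (xs ! n))"
  by (simp add: qapply_def)

text \<open>
  The range of a quasi-matrix of full rank has a basis with as many elements as there are columns.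
  The lemmas on full rank below play this basis against spanning sets by means of the exchange
  lemma: the range is not spanned by fewer vectors, hence the columns are independent, and the range fills
  any space that contains it and is spanned by as many vectors.
\<close>

lemma full_rank_basis:
  assumes "full_rank Q"
  obtains b where "\<not> complex_vector.dependent b" "complex_vector.span b = qrange Q"
    "card b = length Q"
proof -
  obtain b where b: "b \<subseteq> qrange Q" "\<not> complex_vector.dependent b"
    "qrange Q \<subseteq> complex_vector.span b" "card b = complex_vector.dim (qrange Q)"
    using complex_vector.basis_exists .
  moreover have "complex_vector.span b \<subseteq> qrange Q"
    using complex_vector.span_minimal[OF b(1)] by (simp add: qrange_eq_span)
  ultimately show ?thesis using that assms by (simp add: full_rank_def)
qed

lemma full_rank_imp_card_ge:
  assumes "full_rank Q" and T: "finite T" and sub: "qrange Q \<subseteq> complex_vector.span T"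
  shows "length Q \<le> card T"
proof -
  obtain b where b: "\<not> complex_vector.dependent b" "complex_vector.span b = qrange Q"
    "card b = length Q"
    using full_rank_basis[OF assms(1)] .
  then have "b \<subseteq> complex_vector.span T" using sub complex_vector.span_superset by blast
  then show ?thesis using complex_vector.independent_span_bound[OF T b(1)] b(3) by simp
qed

lemma full_rank_kernel:
  assumes rank: "full_rank Q" and zero: "qapply Q x = 0" and n: "n < length Q"
  shows "x n = 0"
proof (rule ccontr)
  assume xn: "x n \<noteq> 0"
  define T where "T = (!) Q ` ({..<length Q} - {n})"
  let ?S = "complex_vector.span T"
  have T: "finite T" "card T \<le> length Q - 1"
    using card_image_le[of "{..<length Q} - {n}" "(!) Q"] n by (auto simp: T_def)
  have rest: "(\<Sum>i\<in>{..<length Q} - {n}. x i *\<^sub>C Q ! i) \<in> ?S"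
    by (intro complex_vector.span_sum complex_vector.span_scale complex_vector.span_base)
      (auto simp: T_def)
  have "qapply Q x = x n *\<^sub>C Q ! n + (\<Sum>i\<in>{..<length Q} - {n}. x i *\<^sub>C Q ! i)"
    unfolding qapply_def using n by (intro sum.remove) auto
  then have "x n *\<^sub>C Q ! n = - (\<Sum>i\<in>{..<length Q} - {n}. x i *\<^sub>C Q ! i)"
    using zero by (simp add: eq_neg_iff_add_eq_0)
  then have "x n *\<^sub>C Q ! n \<in> ?S" using rest complex_vector.span_neg by simp
  then have "(1 / x n) *\<^sub>C x n *\<^sub>C Q ! n \<in> ?S" by (rule complex_vector.span_scale)
  then have "Q ! n \<in> ?S" using xn by (simp add: scaleC_scaleC)
  moreover have "Q ! i \<in> ?S" if "i < length Q" "i \<noteq> n" for i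
    using that by (intro complex_vector.span_base) (auto simp: T_def)
  ultimately have "set Q \<subseteq> ?S"
    unfolding set_conv_nth by blast
  then have "qrange Q \<subseteq> ?S"
    unfolding qrange_eq_span by (simp add: complex_vector.span_minimal)
  then show False
    using full_rank_imp_card_ge[OF rank T(1)] T(2) n by simp
qed

lemma full_rank_range_eq:
  assumes rank: "full_rank Q" and sub: "qrange Q \<subseteq> complex_vector.span T"
    and T: "finite T" "card T \<le> length Q" and v: "v \<in> complex_vector.span T"
  shows "v \<in> qrange Q"
proof (rule ccontr)
  assume nin: "v \<notin> qrange Q"
  obtain b where b: "\<not> complex_vector.dependent b" "complex_vector.span b = qrange Q"
    "card b = length Q"
    using full_rank_basis[OF rank] .
  have ind: "\<not> complex_vector.dependent (insert v b)"
    using nin b by (intro complex_vector.independent_insertI) auto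
  have "insert v b \<subseteq> complex_vector.span T"
    using b(2) sub v complex_vector.span_superset by blast
  then have "finite (insert v b)" "card (insert v b) \<le> card T"
    using complex_vector.independent_span_bound[OF T(1) ind] by auto
  moreover have "v \<notin> b" using nin b(2) complex_vector.span_superset by blast
  ultimately show False using b(3) T(2) by simp
qed

text \<open>
  A linear map under which the columns stay independent is injective on the range, and by
  counting dimensions it reaches all of the target space.
\<close>

lemma full_rank_map_ex1:
  fixes S :: "'h::chilbert_space list"
  assumes lin: "\<And>x y. F (x + y) = F x + F y" "\<And>c x. F (c *\<^sub>C x) = c *\<^sub>C F x"
    and rank: "full_rank (map F S)" and ran: "range F = complex_vector.span T"
    and T: "finite T" "card T \<le> length S" and v: "v \<in> complex_vector.span T"
  shows "\<exists>!s. s \<in> qrange S \<and> F s = v"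
proof -
  have F0: "F 0 = 0" using lin(1)[of 0 0] by simp
  have F_sum: "F (sum f X) = (\<Sum>i\<in>X. F (f i))" for f :: "nat \<Rightarrow> 'h" and X
    by (induction X rule: infinite_finite_induct) (auto simp: F0 lin)
  have F_q: "F (qapply S x) = qapply (map F S) x" for x
    by (simp add: qapply_def F_sum lin)
  have "qrange (map F S) \<subseteq> complex_vector.span T"
    unfolding ran[symmetric] by (auto simp: qrange_def simp flip: F_q)
  then have "v \<in> qrange (map F S)"
    using full_rank_range_eq[OF rank] T v by simp
  then obtain x where x: "v = qapply (map F S) x" by (auto simp: qrange_def)
  show ?thesis
  proof (rule ex1I[of _ "qapply S x"])
    show "qapply S x \<in> qrange S \<and> F (qapply S x) = v" by (simp add: qrange_def F_q x)
  next
    fix s assume s: "s \<in> qrange S \<and> F s = v"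
    then obtain y where y: "s = qapply S y" by (auto simp: qrange_def)
    have "qapply (map F S) (\<lambda>n. y n - x n) = qapply (map F S) y - qapply (map F S) x"
      by (simp add: qapply_def complex_vector.scale_left_diff_distrib sum_subtractf)
    also have "\<dots> = 0" using s x by (simp add: y F_q)
    finally have "y n - x n = 0" if "n < length S" for n
      using full_rank_kernel[OF rank, of "\<lambda>n. y n - x n" n] that by simp
    then show "s = qapply S x" unfolding y qapply_def by (intro sum.cong) auto
  qed
qed

lemma concat_map_map_eq_product:
  "concat (map (\<lambda>k. map (G k) ys) xs) = map (\<lambda>(k, y). G k y) (List.product xs ys)"
  by (induction xs) auto


section \<open>The filter function\<close>

text \<open>
  Vanishing moments give the rule a property of a contour integral around \<open>\<mu>\<close>: applied to
  \<open>t ^ k / (t - \<mu>)\<close> with \<open>k < N\<close>, it pulls out the factor \<open>\<mu> ^ k\<close>, because \<open>t ^ k\<close> and \<open>\<mu> ^ k\<close>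
  differ by \<open>t - \<mu>\<close> times a polynomial in \<open>t\<close> of degree at most \<open>N - 2\<close>.
\<close>

locale moment_quadrature =
  fixes N :: nat and z \<omega> :: "nat \<Rightarrow> complex"
  assumes node_nz: "j \<in> {1..N} \<Longrightarrow> z j \<noteq> 0"
    and inverse_moment_nz: "(\<Sum>j=1..N. \<omega> j * inverse (z j)) \<noteq> 0"
    and moment_zero: "k + 2 \<le> N \<Longrightarrow> (\<Sum>j=1..N. \<omega> j * z j ^ k) = 0"
begin

lemma filter_fun_power:
  assumes mu: "\<And>j. j \<in> {1..N} \<Longrightarrow> z j \<noteq> \<mu>" and k: "k < N"
  shows "(\<Sum>j=1..N. \<omega> j * z j ^ k / (z j - \<mu>)) = \<mu> ^ k * filter_fun N z \<omega> \<mu>"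
  using k
proof (induction k)
  case 0
  then show ?case by (simp add: filter_fun_def)
next
  case (Suc k)
  have "\<omega> j * z j ^ Suc k / (z j - \<mu>) = \<omega> j * z j ^ k + \<mu> * (\<omega> j * z j ^ k / (z j - \<mu>))"
    if "j \<in> {1..N}" for j
    using mu[OF that] by (simp add: field_simps)
  then have "(\<Sum>j=1..N. \<omega> j * z j ^ Suc k / (z j - \<mu>))
      = (\<Sum>j=1..N. \<omega> j * z j ^ k) + \<mu> * (\<Sum>j=1..N. \<omega> j * z j ^ k / (z j - \<mu>))"
    by (simp add: sum.distrib sum_distrib_left)
  then show ?case using Suc moment_zero[of k] by (simp only: add_0_left power_Suc mult.assoc)
qed

lemma filter_fun_poly:
  assumes mu: "\<And>j. j \<in> {1..N} \<Longrightarrow> z j \<noteq> \<mu>" and q: "degree q < N"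
  shows "(\<Sum>j=1..N. \<omega> j * poly q (z j) / (z j - \<mu>)) = poly q \<mu> * filter_fun N z \<omega> \<mu>"
proof -
  have "(\<Sum>j=1..N. \<omega> j * poly q (z j) / (z j - \<mu>))
      = (\<Sum>j=1..N. \<Sum>k\<le>degree q. coeff q k * (\<omega> j * z j ^ k / (z j - \<mu>)))"
    by (simp add: poly_altdef sum_distrib_left sum_divide_distrib ac_simps)
  also have "\<dots> = (\<Sum>k\<le>degree q. coeff q k * (\<Sum>j=1..N. \<omega> j * z j ^ k / (z j - \<mu>)))"
    by (subst sum.swap) (simp add: sum_distrib_left)
  also have "\<dots> = (\<Sum>k\<le>degree q. coeff q k * (\<mu> ^ k * filter_fun N z \<omega> \<mu>))"
    using q by (intro sum.cong refl arg_cong2[of _ _ _ _ "(*)"] filter_fun_power mu) auto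
  also have "\<dots> = poly q \<mu> * filter_fun N z \<omega> \<mu>"
    unfolding poly_altdef sum_distrib_right by (simp only: mult.assoc)
  finally show ?thesis .
qed

text \<open>
  The filter function is a nonzero constant divided by the product of the \<open>1 - \<mu> / z j\<close>.  To see
  this, write the product of the \<open>1 - t / z j\<close> as \<open>1 + t * r t\<close>.  Then \<open>q t = 1 + \<mu> * r t\<close> is a
  polynomial of degree below \<open>N\<close> that agrees with \<open>(t - \<mu>) / t\<close> at the nodes, coinciding ones
  included, so the rule gives the same value for \<open>q t / (t - \<mu>)\<close>
  and for \<open>1 / t\<close>.  The first value is \<open>q \<mu>\<close> times the filter function, the second is not zero.
\<close>

lemma filter_fun_nz:
  assumes mu: "\<And>j. j \<in> {1..N} \<Longrightarrow> z j \<noteq> \<mu>" and N: "N \<ge> 1"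
  shows "filter_fun N z \<omega> \<mu> \<noteq> 0"
proof -
  define p where "p = (\<Prod>j=1..N. [:1, - 1 / z j:])"
  obtain c r where p: "p = pCons c r" by (cases p)
  have "c = poly p 0" by (simp add: p)
  also have "\<dots> = 1" by (simp add: p_def poly_prod)
  finally have c: "c = 1" .
  have "degree p \<le> (\<Sum>j=1..N. degree [:1, - 1 / z j:])"
    unfolding p_def using degree_prod_sum_le[of "{1..N}" "\<lambda>j. [:1, - 1 / z j:]"] by (simp add: o_def)
  also have "\<dots> \<le> (\<Sum>j=1..N. 1)" by (intro sum_mono) simp
  finally have "degree p \<le> N" by simp
  then have "degree r < N" using N by (cases "r = 0") (auto simp: p)
  then have deg: "degree (1 + smult \<mu> r) < N"
    using degree_add_le_max[of 1 "smult \<mu> r"] degree_smult_le[of \<mu> r] N by simp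
  have interp: "\<omega> j * poly (1 + smult \<mu> r) (z j) / (z j - \<mu>) = \<omega> j * inverse (z j)"
    if j: "j \<in> {1..N}" for j
  proof -
    have "poly p (z j) = 0"
      unfolding p_def poly_prod using j node_nz[OF j] by (intro prod_zero) (auto intro: bexI[of _ j])
    then have "poly r (z j) = - 1 / z j"
      using node_nz[OF j] by (simp add: p c eq_neg_iff_add_eq_0 field_simps)
    then show ?thesis using node_nz[OF j] mu[OF j] by (simp add: field_simps)
  qed
  have "poly (1 + smult \<mu> r) \<mu> * filter_fun N z \<omega> \<mu> = (\<Sum>j=1..N. \<omega> j * inverse (z j))"
    using filter_fun_poly[OF mu deg] interp by simp
  then show ?thesis using inverse_moment_nz by auto
qed

end


section \<open>Expansions along a family of projectors\<close>

lemma has_sum_finite_sum: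
  fixes f :: "'j \<Rightarrow> 'i \<Rightarrow> 'a::topological_comm_monoid_add"
  assumes "\<And>n. n \<in> X \<Longrightarrow> (f n has_sum g n) S"
  shows "((\<lambda>i. \<Sum>n\<in>X. f n i) has_sum (\<Sum>n\<in>X. g n)) S"
  using assms
  by (induction X rule: infinite_finite_induct) (auto intro: has_sum_add)

locale spectral_family =
  fixes lam :: "nat \<Rightarrow> complex" and P :: "nat \<Rightarrow> 'h \<Rightarrow> 'h::chilbert_space"
  assumes bounded_linear_P: "i \<ge> 1 \<Longrightarrow> bounded_linear (P i)"
    and P_scaleC: "i \<ge> 1 \<Longrightarrow> P i (c *\<^sub>C x) = c *\<^sub>C P i x"
    and P_P: "i \<ge> 1 \<Longrightarrow> j \<ge> 1 \<Longrightarrow> P i (P j x) = (if i = j then P i x else 0)"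
begin

lemma P_add: "i \<ge> 1 \<Longrightarrow> P i (x + y) = P i x + P i y"
  by (rule linear_add[OF bounded_linear.linear[OF bounded_linear_P]])

lemma P_sum: "i \<ge> 1 \<Longrightarrow> P i (sum g X) = (\<Sum>n\<in>X. P i (g n))"
  by (rule linear_sum[OF bounded_linear.linear[OF bounded_linear_P]])

lemma proj_sum_add: "J \<subseteq> {1..} \<Longrightarrow> proj_sum P J (x + y) = proj_sum P J x + proj_sum P J y"
  unfolding proj_sum_def sum.distrib[symmetric] by (intro sum.cong refl P_add) auto

lemma proj_sum_scaleC: "J \<subseteq> {1..} \<Longrightarrow> proj_sum P J (c *\<^sub>C x) = c *\<^sub>C proj_sum P J x"
  unfolding proj_sum_def complex_vector.scale_sum_right by (intro sum.cong refl P_scaleC) auto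

lemma P_proj_sum:
  assumes "j \<ge> 1" "finite J" "J \<subseteq> {1..}"
  shows "P j (proj_sum P J x) = (if j \<in> J then P j x else 0)"
proof -
  have "P j (proj_sum P J x) = (\<Sum>i\<in>J. P j (P i x))"
    unfolding proj_sum_def using assms by (intro P_sum)
  also have "\<dots> = (\<Sum>i\<in>J. if j = i then P j x else 0)"
    using assms by (intro sum.cong P_P) auto
  finally show ?thesis using assms by simp
qed

lemma proj_sum_idem:
  assumes "finite J" "J \<subseteq> {1..}"
  shows "proj_sum P J (proj_sum P J x) = proj_sum P J x"
proof -
  have "P j (proj_sum P J x) = P j x" if "j \<in> J" for j
    using P_proj_sum[of j J x] assms that by auto
  then show ?thesis by (subst (1 3) proj_sum_def) simp
qed

text \<open>The projectors are continuous, so they may be applied to an expansion term by term.\<close>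

lemma has_sum_component:
  assumes sum: "((\<lambda>i. c i *\<^sub>C P i x) has_sum y) {1..}" and j: "j \<ge> 1"
  shows "P j y = c j *\<^sub>C P j x"
proof -
  have "((\<lambda>i. P j (c i *\<^sub>C P i x)) has_sum P j y) {1..}"
    by (rule has_sum_bounded_linear[OF bounded_linear_P[OF j] sum])
  moreover have "((\<lambda>i. P j (c i *\<^sub>C P i x)) has_sum c j *\<^sub>C P j x) {1..}"
  proof (rule has_sum_cong_neutral[THEN iffD1])
    show "((\<lambda>i. P j (c i *\<^sub>C P i x)) has_sum c j *\<^sub>C P j x) {j}"
      using j by (intro has_sum_finiteI) (auto simp: P_scaleC P_P)
  qed (use j in \<open>auto simp: P_scaleC P_P\<close>)
  ultimately show ?thesis by (rule has_sum_unique)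
qed

lemma component_specC_power:
  assumes dom: "\<And>k. Suc k < M \<Longrightarrow> (specC lam P ^^ k) v \<in> specC_dom lam P"
    and k: "k < M" and j: "j \<ge> 1"
  shows "P j ((specC lam P ^^ k) v) = lam j ^ k *\<^sub>C P j v"
  using k
proof (induction k)
  case 0
  then show ?case by simp
next
  case (Suc k)
  let ?x = "(specC lam P ^^ k) v"
  have "((\<lambda>i. lam i *\<^sub>C P i ?x) has_sum specC lam P ?x) {1..}"
    using dom[of k] Suc.prems unfolding specC_dom_def specC_def by (simp add: has_sum_infsum)
  then have "P j (specC lam P ?x) = lam j *\<^sub>C P j ?x" using j by (rule has_sum_component)
  with Suc show ?case by (simp add: scaleC_scaleC)
qed

text \<open>
  Here \<open>w l\<close> is the \<open>l\<close>-fold filtered \<open>s\<close>.  Its first \<open>n\<close> components, divided by \<open>f i ^ l\<close>, are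
  those of \<open>u\<close>, since the filter acts on \<open>u\<close> as the number \<open>f i\<close>.  In the remaining ones,
  the \<open>j\<close>-th component of the \<open>l\<close>-fold filtered \<open>s\<close> is \<open>f (n + 1) ^ l\<close> times
  \<open>(f j / f (n + 1)) ^ (l - 1)\<close>, a number of modulus at most \<open>1\<close>, times the component of the
  once filtered \<open>s\<close>, divided by \<open>f (n + 1)\<close>.  One factor \<open>f j\<close> has to stay with
  the vector: it is the once filtered series that is known to converge unconditionally, not the series of the components of \<open>s\<close>.
  The bound obtained for the multipliers does not involve \<open>u - s\<close>; if \<open>u \<noteq> s\<close>, it is divided by
  \<open>norm (u - s)\<close>, and if \<open>u = s\<close>, the remaining components are all zero.
\<close>

lemma filtered_remainder_bound:
  assumes dec: "\<And>j. j \<ge> 1 \<Longrightarrow> cmod (f (Suc j)) \<le> cmod (f j)"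
    and nz: "\<And>j. j \<ge> 1 \<Longrightarrow> f j \<noteq> 0"
    and s: "proj_sum P {1..n} s = u"
    and i: "i \<in> {1..n}"
    and eig: "\<And>j. j \<in> {1..n} \<Longrightarrow> P j u \<noteq> 0 \<Longrightarrow> f j = f i"
    and w: "\<And>l. l \<ge> 1 \<Longrightarrow> ((\<lambda>j. f j ^ l *\<^sub>C P j s) has_sum w l) {1..}"
  shows "\<exists>\<alpha>\<ge>0. \<forall>l\<ge>1. norm (u - (1 / f i ^ l) *\<^sub>C w l)
           \<le> \<alpha> * norm (u - s) * cmod (f (Suc n) / f i) ^ l"
proof -
  have fi: "f i \<noteq> 0" and fn: "f (Suc n) \<noteq> 0" using nz i by auto
  have Pu: "P j u = (if j \<in> {1..n} then P j s else 0)" if "j \<ge> 1" for j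
    using P_proj_sum[of j "{1..n}" s] that s by auto
  have u: "(\<Sum>j=1..n. P j u) = u"
    using proj_sum_idem[of "{1..n}" s] s by (auto simp: proj_sum_def)
  have tail: "((\<lambda>j. (f j / f i) ^ l *\<^sub>C P j s) has_sum ((1 / f i ^ l) *\<^sub>C w l - u)) {Suc n..}"
    if l: "l \<ge> 1" for l
  proof -
    let ?g = "\<lambda>j. (f j / f i) ^ l *\<^sub>C P j s"
    have "(?g has_sum ((1 / f i ^ l) *\<^sub>C w l)) {1..}"
      using has_sum_scaleC[OF w[OF l], of "1 / f i ^ l"]
      by (simp add: scaleC_scaleC power_divide)
    moreover have "?g j = P j u" if j: "j \<in> {1..n}" for j
    proof (cases "P j u = 0")
      case True
      then show ?thesis using Pu[of j] j by simp
    next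
      case False
      then show ?thesis using Pu[of j] j eig[OF j] fi by simp
    qed
    then have "(?g has_sum u) {1..n}"
      using u by (intro has_sum_finiteI) auto
    then have "((\<lambda>j. if j \<in> {1..n} then ?g j else 0) has_sum u) {1..}"
      by (rule has_sum_cong_neutral[THEN iffD1, rotated -1]) auto
    ultimately have "((\<lambda>j. ?g j + - (if j \<in> {1..n} then ?g j else 0)) has_sum
        ((1 / f i ^ l) *\<^sub>C w l + - u)) {1..}"
      by (intro has_sum_add) (auto simp: has_sum_uminus simp del: atLeastAtMost_iff)
    then show ?thesis
      by (subst (asm) has_sum_cong_neutral[where T = "{Suc n..}" and g = ?g]) auto
  qed
  show ?thesis
  proof (cases "s = u")
    case True
    have "u - (1 / f i ^ l) *\<^sub>C w l = 0" if l: "l \<ge> 1" for l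
    proof -
      have "((\<lambda>j. (f j / f i) ^ l *\<^sub>C P j s) has_sum 0) {Suc n..}"
        by (rule has_sum_0) (use Pu True in auto)
      then have "(1 / f i ^ l) *\<^sub>C w l - u = 0" by (rule has_sum_unique[OF tail[OF l]])
      then show ?thesis by simp
    qed
    then show ?thesis using True by auto
  next
    case False
    define a where "a = (\<lambda>j. (f j / f (Suc n)) *\<^sub>C P j s)"
    have "a summable_on {Suc n..}"
      using has_sum_scaleC[OF tail[of 1], of "f i / f (Suc n)"] fi
      by (auto simp: a_def scaleC_scaleC summable_on_def)
    then obtain K where K: "K \<ge> 0"
      and bound: "\<And>m y. \<forall>j\<in>{Suc n..}. cmod (m j) \<le> 1 \<Longrightarrow>
        ((\<lambda>j. m j *\<^sub>C a j) has_sum y) {Suc n..} \<Longrightarrow> norm y \<le> K"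
      using has_sum_multipliers_bounded by metis
    have le: "cmod (f j) \<le> cmod (f (Suc n))" if "j \<ge> Suc n" for j
      using that
    proof (induction j rule: dec_induct)
      case (step m)
      then show ?case using dec[of m] by simp
    qed simp
    have "norm (u - (1 / f i ^ l) *\<^sub>C w l) \<le> K * cmod (f (Suc n) / f i) ^ l" if l: "l \<ge> 1" for l
    proof -
      obtain k where k: "l = Suc k" using l by (cases l) auto
      let ?r = "(f i / f (Suc n)) ^ l" and ?y = "(1 / f i ^ l) *\<^sub>C w l - u"
      have "?r *\<^sub>C (f j / f i) ^ l *\<^sub>C P j s = (f j / f (Suc n)) ^ k *\<^sub>C a j" for j
        using fi fn by (simp add: a_def scaleC_scaleC k power_divide mult.commute)
      then have "((\<lambda>j. (f j / f (Suc n)) ^ k *\<^sub>C a j) has_sum ?r *\<^sub>C ?y) {Suc n..}"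
        using has_sum_scaleC[OF tail[OF l], of ?r] by simp
      moreover have "cmod ((f j / f (Suc n)) ^ k) \<le> 1" if "j \<ge> Suc n" for j
        using le[OF that] fn by (simp add: norm_power norm_divide power_le_one)
      ultimately have "norm (?r *\<^sub>C ?y) \<le> K" by (intro bound) auto
      then have "cmod (f (Suc n) / f i) ^ l * norm (?r *\<^sub>C ?y) \<le> cmod (f (Suc n) / f i) ^ l * K"
        by (intro mult_left_mono) auto
      moreover have "cmod (f (Suc n) / f i) ^ l * norm (?r *\<^sub>C ?y) = norm ?y"
        using fi fn by (simp add: norm_scaleC norm_power norm_divide power_divide)
      ultimately show ?thesis by (simp add: norm_minus_commute mult.commute)
    qed
    then show ?thesis
      using K False by (intro exI[of _ "K / norm (u - s)"]) auto
  qed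
qed

end


section \<open>The filtered subspace iteration\<close>

locale filtered_pencil = spectral_family lam P + moment_quadrature N z \<omega>
  for lam :: "nat \<Rightarrow> complex" and P :: "nat \<Rightarrow> 'h \<Rightarrow> 'h::chilbert_space"
    and N :: nat and z \<omega> :: "nat \<Rightarrow> complex" +
  fixes A B :: "'h \<Rightarrow> 'h" and D DB :: "'h set"
  assumes N_pos: "N \<ge> 1"
    and subspace_DB: "complex_vector.subspace DB"
    and node_regular: "j \<in> {1..N} \<Longrightarrow> i \<ge> 1 \<Longrightarrow> z j \<noteq> lam i"
    and solution_in_DB: "j \<in> {1..N} \<Longrightarrow> solution_op A B D (z j) h \<in> DB"
    and resolvent_expansion: "j \<in> {1..N} \<Longrightarrow> x \<in> DB \<Longrightarrow>
      ((\<lambda>i. (1 / (z j - lam i)) *\<^sub>C P i x) has_sum solution_op A B D (z j) (B x)) {1..}"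
begin

abbreviation flt :: "nat \<Rightarrow> complex" where
  "flt i \<equiv> filter_fun N z \<omega> (lam i)"

abbreviation moment :: "nat \<Rightarrow> 'h \<Rightarrow> 'h" where
  "moment \<equiv> moment_op A B D N z \<omega>"

lemma moment_in_DB: "moment k v \<in> DB"
  unfolding moment_op_def
  by (intro complex_vector.subspace_sum complex_vector.subspace_scale subspace_DB solution_in_DB)

lemma has_sum_moment:
  assumes v: "v \<in> DB" and k: "k < N"
  shows "((\<lambda>i. (lam i ^ k * flt i) *\<^sub>C P i v) has_sum moment k v) {1..}"
proof -
  have "((\<lambda>i. \<Sum>j=1..N. (\<omega> j * z j ^ k) *\<^sub>C (1 / (z j - lam i)) *\<^sub>C P i v) has_sum moment k v) {1..}"
    unfolding moment_op_def
    by (intro has_sum_finite_sum has_sum_scaleC resolvent_expansion v)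
  moreover have "(\<Sum>j=1..N. (\<omega> j * z j ^ k) *\<^sub>C (1 / (z j - lam i)) *\<^sub>C P i v)
      = (lam i ^ k * flt i) *\<^sub>C P i v" if "i \<in> {1..}" for i
    using filter_fun_power[of "lam i" k] k node_regular that
    by (simp add: scaleC_scaleC flip: complex_vector.scale_sum_left)
  ultimately show ?thesis
    by (simp only: cong: has_sum_cong)
qed

lemma moment0_power:
  assumes v: "v \<in> DB"
  shows "(moment 0 ^^ \<nu>) v \<in> DB \<and> (\<forall>j\<ge>1. P j ((moment 0 ^^ \<nu>) v) = flt j ^ \<nu> *\<^sub>C P j v)"
proof (induction \<nu>)
  case 0
  then show ?case using v by simp
next
  case (Suc \<nu>)
  have "P j (moment 0 x) = flt j *\<^sub>C P j x" if "j \<ge> 1" "x \<in> DB" for j x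
    using has_sum_component[OF has_sum_moment] that N_pos by fastforce
  with Suc show ?case by (simp add: moment_in_DB scaleC_scaleC)
qed

lemma S0_iter_eq: "S0_iter A B D N z \<omega> V \<nu> = map (moment 0 ^^ \<nu>) V"
  by (induction \<nu>) auto

lemma S_hat_eq:
  "S_hat A B D N z \<omega> M V l
    = map (\<lambda>(k, v). moment k ((moment 0 ^^ (l - 1)) v)) (List.product [0..<M] V)"
  unfolding S_hat_def S0_iter_eq by (simp add: o_def concat_map_map_eq_product)

lemma S_init_eq:
  "S_init lam P M V = map (\<lambda>(k, v). (specC lam P ^^ k) v) (List.product [0..<M] V)"
  unfolding S_init_def by (rule concat_map_map_eq_product)

text \<open>
  Combining the columns of the \<open>l\<close>-th iterate with the coefficients of \<open>s\<close> filters \<open>s\<close> exactly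
  \<open>l\<close> times.  In the \<open>k\<close>-th block the preceding steps contribute \<open>flt j ^ (l - 1)\<close> to the \<open>j\<close>-th
  component and the \<open>k\<close>-th moment contributes \<open>lam j ^ k * flt j\<close>, whose first factor is what the
  \<open>k\<close>-th power of \<open>specC lam P\<close> contributes to the same component of \<open>s\<close>.
\<close>

lemma has_sum_S_hat:
  assumes V: "set V \<subseteq> DB" and M: "M \<le> N"
    and dom: "\<And>v k. v \<in> set V \<Longrightarrow> Suc k < M \<Longrightarrow> (specC lam P ^^ k) v \<in> specC_dom lam P"
    and s: "s \<in> qrange (S_init lam P M V)" and l: "l \<ge> 1"
  shows "\<exists>w\<in>qrange (S_hat A B D N z \<omega> M V l). ((\<lambda>j. flt j ^ l *\<^sub>C P j s) has_sum w) {1..}"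
proof -
  define idx where "idx = List.product [0..<M] V"
  obtain x where x: "s = qapply (S_init lam P M V) x" using s by (auto simp: qrange_def)
  define w where "w = qapply (S_hat A B D N z \<omega> M V l) x"
  let ?k = "\<lambda>n. fst (idx ! n)" and ?v = "\<lambda>n. snd (idx ! n)"
  have idx: "?k n < M" "?v n \<in> set V" if "n < length idx" for n
    using nth_mem[OF that] by (auto simp: idx_def)
  have s_eq: "s = (\<Sum>n<length idx. x n *\<^sub>C (specC lam P ^^ ?k n) (?v n))"
    unfolding x S_init_eq qapply_map by (simp add: idx_def split_beta)
  have w_eq: "w = (\<Sum>n<length idx. x n *\<^sub>C moment (?k n) ((moment 0 ^^ (l - 1)) (?v n)))"
    unfolding w_def S_hat_eq qapply_map by (simp add: idx_def split_beta)
  have Ps: "P j s = (\<Sum>n<length idx. x n *\<^sub>C lam j ^ ?k n *\<^sub>C P j (?v n))" if j: "j \<ge> 1" for j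
    unfolding s_eq P_sum[OF j] P_scaleC[OF j]
  proof (intro sum.cong refl arg_cong2[of _ _ _ _ scaleC])
    fix n assume "n \<in> {..<length idx}"
    then show "P j ((specC lam P ^^ ?k n) (?v n)) = lam j ^ ?k n *\<^sub>C P j (?v n)"
      using idx j by (intro component_specC_power[where M = M] dom) auto
  qed
  have "((\<lambda>j. \<Sum>n<length idx. x n *\<^sub>C (lam j ^ ?k n * flt j) *\<^sub>C P j ((moment 0 ^^ (l - 1)) (?v n)))
      has_sum w) {1..}"
    unfolding w_eq
  proof (intro has_sum_finite_sum has_sum_scaleC has_sum_moment)
    fix n assume n: "n \<in> {..<length idx}"
    show "(moment 0 ^^ (l - 1)) (?v n) \<in> DB" using moment0_power idx[of n] n V by auto
    show "?k n < N" using idx[of n] n M by auto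
  qed
  moreover have "(\<Sum>n<length idx. x n *\<^sub>C (lam j ^ ?k n * flt j) *\<^sub>C P j ((moment 0 ^^ (l - 1)) (?v n)))
      = flt j ^ l *\<^sub>C P j s" if j: "j \<in> {1..}" for j
  proof -
    have "flt j ^ l = flt j * flt j ^ (l - 1)" using l by (cases l) auto
    moreover have "P j ((moment 0 ^^ (l - 1)) (?v n)) = flt j ^ (l - 1) *\<^sub>C P j (?v n)"
      if "n < length idx" for n
      using moment0_power idx[OF that] j V by auto
    moreover have "j \<ge> 1" using j by simp
    ultimately show ?thesis
      by (simp add: Ps complex_vector.scale_sum_right scaleC_scaleC ac_simps)
  qed
  ultimately have "((\<lambda>j. flt j ^ l *\<^sub>C P j s) has_sum w) {1..}"
    by (simp only: cong: has_sum_cong)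
  moreover have "w \<in> qrange (S_hat A B D N z \<omega> M V l)" by (simp add: w_def qrange_def)
  ultimately show ?thesis by blast
qed

end


section \<open>Eigenfunctions and the boundary conditions\<close>

lemma subspace_bc_domain:
  assumes "complex_vector.subspace DA" "complex_vector.subspace DB"
    and "\<forall>b\<in>BC. boundary_functional I ev (DA \<inter> DB) b"
  shows "complex_vector.subspace (bc_domain DA DB BC)"
proof -
  have b_add: "b (x + y) = b x + b y"
    if "b \<in> BC" "x \<in> DA \<inter> DB" "y \<in> DA \<inter> DB" for b x y
    using that assms(3) unfolding boundary_functional_def cfunctional_on_def by blast
  have b_scale: "b (c *\<^sub>C x) = c * b x" if "b \<in> BC" "x \<in> DA \<inter> DB" for b c x
    using that assms(3) unfolding boundary_functional_def cfunctional_on_def by blast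
  have sub: "complex_vector.subspace (DA \<inter> DB)"
    by (rule complex_vector.subspace_inter[OF assms(1,2)])
  have "b 0 = 0" if "b \<in> BC" for b
    using b_scale[OF that, of 0 0] complex_vector.subspace_0[OF sub] by simp
  then have "0 \<in> bc_domain DA DB BC"
    using complex_vector.subspace_0[OF sub] by (simp add: bc_domain_def)
  moreover have "x + y \<in> bc_domain DA DB BC"
    if xy: "x \<in> bc_domain DA DB BC" "y \<in> bc_domain DA DB BC" for x y
  proof -
    have "b (x + y) = 0" if "b \<in> BC" for b
    proof -
      have "b x = 0" "b y = 0" "x \<in> DA \<inter> DB" "y \<in> DA \<inter> DB"
        using xy that unfolding bc_domain_def by blast+
      then show ?thesis using b_add[OF that] by simp
    qed
    then show ?thesis
      using xy complex_vector.subspace_add[OF sub, of x y] by (simp add: bc_domain_def)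
  qed
  moreover have "c *\<^sub>C x \<in> bc_domain DA DB BC" if x: "x \<in> bc_domain DA DB BC" for c x
  proof -
    have "b (c *\<^sub>C x) = 0" if "b \<in> BC" for b
    proof -
      have "b x = 0" "x \<in> DA \<inter> DB" using x that unfolding bc_domain_def by blast+
      then show ?thesis using b_scale[OF that] by simp
    qed
    then show ?thesis
      using x complex_vector.subspace_scale[OF sub, of x c] by (simp add: bc_domain_def)
  qed
  ultimately show ?thesis unfolding complex_vector.subspace_def by blast
qed

text \<open>
  On an eigenfunction the solution operator is known explicitly.  Comparison with the expansion of
  the resolvent then shows in which components an eigenfunction can be nonzero.
\<close>

lemma solution_op_eigenfunction:
  assumes A: "clinear_on DA A" and B: "clinear_on DB B"
    and D: "complex_vector.subspace D" "D \<subseteq> DA \<inter> DB"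
    and inj: "inj_on (\<lambda>u. \<zeta> *\<^sub>C B u - A u) D"
    and eig: "eigenpair A B D \<mu> u" and \<zeta>: "\<zeta> \<noteq> \<mu>"
  shows "solution_op A B D \<zeta> (B u) = (1 / (\<zeta> - \<mu>)) *\<^sub>C u"
proof -
  let ?x = "(1 / (\<zeta> - \<mu>)) *\<^sub>C u"
  have u: "u \<in> D" "A u = \<mu> *\<^sub>C B u" using eig by (auto simp: eigenpair_def)
  have x: "?x \<in> D" using D(1) u(1) by (rule complex_vector.subspace_scale)
  have "A ?x = (1 / (\<zeta> - \<mu>)) *\<^sub>C A u" "B ?x = (1 / (\<zeta> - \<mu>)) *\<^sub>C B u"
    using A B u D(2) unfolding clinear_on_def by blast+
  then have "\<zeta> *\<^sub>C B ?x - A ?x = (\<zeta> * (1 / (\<zeta> - \<mu>)) - (1 / (\<zeta> - \<mu>)) * \<mu>) *\<^sub>C B u"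
    by (simp add: u scaleC_scaleC complex_vector.scale_left_diff_distrib)
  also have "\<zeta> * (1 / (\<zeta> - \<mu>)) - (1 / (\<zeta> - \<mu>)) * \<mu> = 1"
    using \<zeta> by (simp flip: diff_divide_distrib)
  finally have "B u = \<zeta> *\<^sub>C B ?x - A ?x" by simp
  then show ?thesis
    unfolding solution_op_def using inv_into_f_f[OF inj x] by simp
qed

theorem theorem3p4:
  fixes I :: "real set"
    and ev :: "'h::chilbert_space \<Rightarrow> real \<Rightarrow> complex"
    and A B :: "'h \<Rightarrow> 'h"
    and DA DB D :: "'h set"
    and BC :: "('h \<Rightarrow> complex) set"
    and \<Omega> :: "complex set"
    and lam :: "nat \<Rightarrow> complex"
    and P :: "nat \<Rightarrow> 'h \<Rightarrow> 'h"
    and u :: "nat \<Rightarrow> 'h"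
    and L M N :: nat
    and z \<omega> :: "nat \<Rightarrow> complex"
    and V :: "'h list"
  assumes "function_space I ev"
    and "linear_ode_operator I ev DA A"
    and "linear_ode_operator I ev DB B"
    and "\<forall>b\<in>BC. boundary_functional I ev (DA \<inter> DB) b"
    and "D = bc_domain DA DB BC"
    and "bij_betw B DB UNIV"
    \<comment> \<open>the region, and the discrete spectrum\<close>
    and "open \<Omega>" and "simply_connected \<Omega>"
    and "\<exists>\<gamma>. rectifiable \<gamma> \<and> simple_path \<gamma> \<and> pathfinish \<gamma> = pathstart \<gamma> \<and>
             path_image \<gamma> = frontier \<Omega>"
    and "spectrum A B D = lam ` {1..}"
    and "discrete (spectrum A B D)"
    and "spectrum A B D \<inter> frontier \<Omega> = {}"
    and "finite {i. 1 \<le> i \<and> lam i \<in> \<Omega>}"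
    and "\<exists>E. finite E \<and> (\<forall>v\<in>E. \<exists>\<mu>\<in>\<Omega>. eigenpair A B D \<mu> v) \<and>
             \<not> complex_vector.dependent E \<and>
             complex_vector.span E = range (proj_sum P {i. 1 \<le> i \<and> lam i \<in> \<Omega>})"
    \<comment> \<open>the spectral expansion\<close>
    and "\<forall>i\<ge>1. spectral_projector A B D (lam i) (P i)"
    and "\<forall>i\<ge>1. \<forall>j\<ge>1. \<forall>x. P i (P j x) = (if i = j then P i x else 0)"
    and "\<forall>\<zeta>. \<zeta> \<notin> spectrum A B D \<longrightarrow>
           (\<forall>x\<in>DB. ((\<lambda>i. (1 / (\<zeta> - lam i)) *\<^sub>C P i x) has_sum solution_op A B D \<zeta> (B x)) {1..})"
    \<comment> \<open>quadrature rule and starting quasi-matrix\<close>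
    and "L \<ge> 1" and "M \<ge> 1" and "N \<ge> 1" and "M \<le> N"
    and "\<forall>j\<in>{1..N}. z j \<noteq> 0 \<and> z j \<notin> spectrum A B D"
    and "(\<Sum>j=1..N. \<omega> j * inverse (z j)) \<noteq> 0"
    and "\<forall>k. k + 2 \<le> N \<longrightarrow> (\<Sum>j=1..N. \<omega> j * z j ^ k) = 0"
    and "length V = L"
    and "set V \<subseteq> DB"
    and "\<forall>v\<in>set V. \<forall>k. Suc k < M \<longrightarrow> (specC lam P ^^ k) v \<in> specC_dom lam P"
    \<comment> \<open>eigenpairs, ordering and the rank condition\<close>
    and "\<forall>i\<in>{1..L*M}. eigenpair A B D (lam i) (u i)"
    and "\<forall>i\<ge>1. cmod (filter_fun N z \<omega> (lam i)) \<ge> cmod (filter_fun N z \<omega> (lam (i + 1)))"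
    and "range (proj_sum P {1..L*M}) = complex_vector.span (u ` {1..L*M})"
    and "full_rank (map (proj_sum P {1..L*M}) (S_init lam P M V))"
  shows "(\<forall>i\<in>{1..L*M}. \<exists>!s. s \<in> qrange (S_init lam P M V) \<and> proj_sum P {1..L*M} s = u i) \<and>
    (\<exists>\<alpha>::real. \<forall>i\<in>{1..L*M}. \<forall>s. s \<in> qrange (S_init lam P M V) \<and> proj_sum P {1..L*M} s = u i \<longrightarrow>
       (\<forall>l\<ge>1. norm (u i - orth_proj (qrange (S_hat A B D N z \<omega> M V l)) (u i))
          \<le> \<alpha> * norm (u i - s) *
            cmod (filter_fun N z \<omega> (lam (L*M + 1)) / filter_fun N z \<omega> (lam i)) ^ l))"
proof -
  note bc = assms(4) and D = assms(5) and spec = assms(10) and projector = assms(15)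
    and orth = assms(16) and expansion = assms(17) and L = assms(18) and M = assms(19)
    and N = assms(20) and MN = assms(21) and nodes = assms(22) and V = assms(25,26)
    and dom = assms(27) and eig = assms(28) and dec = assms(29) and ran = assms(30)
    and rank = assms(31)
  have A: "clinear_on DA A" and B: "clinear_on DB B"
    using assms(2,3) by (auto simp: linear_ode_operator_def)
  then have subspaces: "complex_vector.subspace DA" "complex_vector.subspace DB"
    by (auto simp: clinear_on_def)
  then have subspace_D: "complex_vector.subspace D"
    unfolding D using bc by (rule subspace_bc_domain)
  have D_sub: "D \<subseteq> DA \<inter> DB" by (auto simp: D bc_domain_def)
  have regular: "bij_betw (\<lambda>u. z j *\<^sub>C B u - A u) D UNIV" if "j \<in> {1..N}" for j
    using nodes that by (auto simp: spectrum_def)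
  have node_lam: "z j \<noteq> lam i" if "j \<in> {1..N}" "i \<ge> 1" for i j
    using nodes spec that by auto
  interpret filtered_pencil lam P N z \<omega> A B D DB
  proof (intro filtered_pencil.intro spectral_family.intro moment_quadrature.intro
      filtered_pencil_axioms.intro)
    show "solution_op A B D (z j) h \<in> DB" if "j \<in> {1..N}" for j h
      unfolding solution_op_def
      using inv_into_into[of h "\<lambda>u. z j *\<^sub>C B u - A u" D] regular[OF that] D_sub
      by (auto simp: bij_betw_def)
  qed (use projector orth expansion N assms(23,24) nodes node_lam subspaces
      in \<open>auto simp: spectral_projector_def\<close>)
  define n where "n = L * M"
  define S where "S = S_init lam P M V"
  let ?Q = "\<lambda>l. qrange (S_hat A B D N z \<omega> M V l)"
  have "length S = n"
    by (simp add: S_def S_init_eq n_def V(1))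
  then have card: "card (u ` {1..n}) \<le> length S"
    using card_image_le[of "{1..n}" u] by simp
  have ex1: "\<exists>!s. s \<in> qrange S \<and> proj_sum P {1..n} s = u i" if "i \<in> {1..n}" for i
  proof (rule full_rank_map_ex1[where T = "u ` {1..n}"])
    show "full_rank (map (proj_sum P {1..n}) S)" using rank by (simp add: n_def S_def)
    show "range (proj_sum P {1..n}) = complex_vector.span (u ` {1..n})"
      using ran by (simp add: n_def)
    show "u i \<in> complex_vector.span (u ` {1..n})"
      using that by (intro complex_vector.span_base) auto
  qed (use card in \<open>auto simp: proj_sum_add proj_sum_scaleC\<close>)
  have flt_eq: "flt j = flt i" if i: "i \<in> {1..n}" and j: "j \<in> {1..n}" and ne: "P j (u i) \<noteq> 0" for i j
  proof -
    have ui: "eigenpair A B D (lam i) (u i)" using eig i by (simp add: n_def)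
    have node: "1 \<in> {1..N}" using N by simp
    \<comment> \<open>the component \<open>P j\<close> of the solution for \<open>B (u i)\<close> is computed in two ways\<close>
    have "solution_op A B D (z 1) (B (u i)) = (1 / (z 1 - lam i)) *\<^sub>C u i"
      using bij_betw_imp_inj_on[OF regular[OF node]] ui node_lam[OF node] i
      by (intro solution_op_eigenfunction[OF A B subspace_D D_sub]) auto
    moreover have "u i \<in> DB" using ui D_sub by (auto simp: eigenpair_def)
    ultimately have "P j ((1 / (z 1 - lam i)) *\<^sub>C u i) = (1 / (z 1 - lam j)) *\<^sub>C P j (u i)"
      using has_sum_component[OF resolvent_expansion[OF node], of "u i" j] j by simp
    then have "(1 / (z 1 - lam i)) *\<^sub>C P j (u i) = (1 / (z 1 - lam j)) *\<^sub>C P j (u i)"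
      using j by (simp add: P_scaleC)
    then have "1 / (z 1 - lam i) = 1 / (z 1 - lam j)"
      using ne complex_vector.scale_cancel_right by blast
    then show ?thesis by simp
  qed
  have "\<exists>\<alpha>\<ge>0. \<forall>s. s \<in> qrange S \<and> proj_sum P {1..n} s = u i \<longrightarrow>
      (\<forall>l\<ge>1. norm (u i - orth_proj (?Q l) (u i))
        \<le> \<alpha> * norm (u i - s) * cmod (flt (Suc n) / flt i) ^ l)"
    if i: "i \<in> {1..n}" for i
  proof -
    obtain s where s: "s \<in> qrange S" "proj_sum P {1..n} s = u i"
      and uniq: "\<And>t. t \<in> qrange S \<and> proj_sum P {1..n} t = u i \<Longrightarrow> t = s"
      using ex1[OF i] by (elim ex1E) blast
    have "\<forall>l. \<exists>w. l \<ge> 1 \<longrightarrow> w \<in> ?Q l \<and> ((\<lambda>j. flt j ^ l *\<^sub>C P j s) has_sum w) {1..}"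
      using has_sum_S_hat[OF V(2) MN _ s(1)[unfolded S_def]] dom by blast
    then obtain w where w: "\<And>l. l \<ge> 1 \<Longrightarrow> w l \<in> ?Q l"
      and sums: "\<And>l. l \<ge> 1 \<Longrightarrow> ((\<lambda>j. flt j ^ l *\<^sub>C P j s) has_sum w l) {1..}"
      by metis
    have "\<exists>\<alpha>\<ge>0. \<forall>l\<ge>1. norm (u i - (1 / flt i ^ l) *\<^sub>C w l)
        \<le> \<alpha> * norm (u i - s) * cmod (flt (Suc n) / flt i) ^ l"
      using dec node_lam N sums
      by (intro filtered_remainder_bound s(2) i flt_eq[OF i] filter_fun_nz) auto
    then obtain \<alpha> where \<alpha>: "\<alpha> \<ge> 0"
      and le: "\<And>l. l \<ge> 1 \<Longrightarrow> norm (u i - (1 / flt i ^ l) *\<^sub>C w l)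
        \<le> \<alpha> * norm (u i - s) * cmod (flt (Suc n) / flt i) ^ l"
      by blast
    have "norm (u i - orth_proj (?Q l) (u i)) \<le> norm (u i - (1 / flt i ^ l) *\<^sub>C w l)"
      if "l \<ge> 1" for l
      using w[OF that] unfolding qrange_eq_span
      by (intro norm_diff_orth_proj_le[OF _ refl] complex_vector.span_scale) auto
    then have near: "norm (u i - orth_proj (?Q l) (u i))
        \<le> \<alpha> * norm (u i - s) * cmod (flt (Suc n) / flt i) ^ l" if "l \<ge> 1" for l
      using le[OF that] that order_trans by blast
    show ?thesis
    proof (intro exI[of _ \<alpha>] conjI \<alpha> allI impI)
      fix t l assume "t \<in> qrange S \<and> proj_sum P {1..n} t = u i" and l: "1 \<le> (l::nat)"
      then have "t = s" by (intro uniq)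
      then show "norm (u i - orth_proj (?Q l) (u i))
          \<le> \<alpha> * norm (u i - t) * cmod (flt (Suc n) / flt i) ^ l"
        using near[OF l] by simp
    qed
  qed
  then obtain \<alpha> where bounds: "\<forall>i\<in>{1..n}. \<alpha> i \<ge> 0 \<and>
      (\<forall>s. s \<in> qrange S \<and> proj_sum P {1..n} s = u i \<longrightarrow>
        (\<forall>l\<ge>1. norm (u i - orth_proj (?Q l) (u i))
          \<le> \<alpha> i * norm (u i - s) * cmod (flt (Suc n) / flt i) ^ l))"
    by (rule bchoice[OF ballI, THEN exE])
  \<comment> \<open>there are only finitely many eigenfunctions, so the sum of their constants serves for all\<close>
  have "norm (u i - orth_proj (?Q l) (u i))
      \<le> (\<Sum>i=1..n. \<alpha> i) * norm (u i - s) * cmod (flt (Suc n) / flt i) ^ l"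
    if "i \<in> {1..n}" "s \<in> qrange S" "proj_sum P {1..n} s = u i" "l \<ge> 1" for i s l
  proof -
    have "\<alpha> i \<le> (\<Sum>i=1..n. \<alpha> i)" using that bounds by (intro member_le_sum) auto
    then have "\<alpha> i * norm (u i - s) * cmod (flt (Suc n) / flt i) ^ l
        \<le> (\<Sum>i=1..n. \<alpha> i) * norm (u i - s) * cmod (flt (Suc n) / flt i) ^ l"
      by (intro mult_right_mono) auto
    moreover have "norm (u i - orth_proj (?Q l) (u i))
        \<le> \<alpha> i * norm (u i - s) * cmod (flt (Suc n) / flt i) ^ l"
      using bounds that by blast
    ultimately show ?thesis by (rule order_trans[rotated])
  qed
  then show ?thesis
    using ex1 unfolding n_def S_def Suc_eq_plus1 by (intro conjI exI[of _ "\<Sum>i=1..L * M. \<alpha> i"]) blast+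
qed

end
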